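(* Let $\mathbf{M}$ be a matroid representable over a field of characteristic zero, with ground set $E$ and rank function $r$. Let $A,B \subseteq E$ with $|A|=|B|=r(E)$, and let $X \subseteq A \setminus B$ and $Y \subseteq B \setminus A$ be subsets such that $r(X\cup Y) < |A \setminus B|$. Suppose there exists exactly one pair $(U,V)$ with $U \subseteq A \setminus B$ and $V\subseteq B \setminus A$ such that $X \subseteq U$, $Y \subseteq V$, $|U| = |V| \le r(X\cup Y)$, and both $(A\setminus U)\cup V$ and $(B\setminus V)\cup U$ are bases of $\mathbf{M}$. Then $A$ and $B$ are bases of $\mathbf{M}$.
   Context: A matroid on ground set identified with $[n]$ is representable over a field $\mathbb{F}$ if there is a matrix $M\in\mathbb{F}^{r\times n}$ such that the bases are exactly the sets $B$ for which the column submatrix $M[B]$ is square and nonsingular. The rank function is $r(S)=\max\{|S\cap B|: B \text{ a basis}\}$. *)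

theory Defs
  imports "Jordan_Normal_Form.Determinant" "Jordan_Normal_Form.DL_Submatrix"
begin

locale matroid =
  fixes E :: "'a set" and Bs :: "'a set set"
  assumes finite_ground: "finite E"
    and bases_subset: "B \<in> Bs \<Longrightarrow> B \<subseteq> E"
    and bases_nonempty: "Bs \<noteq> {}"
    and basis_exchange:
      "\<lbrakk>B1 \<in> Bs; B2 \<in> Bs; x \<in> B1 - B2\<rbrakk> \<Longrightarrow> \<exists>y\<in>B2 - B1. insert y (B1 - {x}) \<in> Bs"

definition matroid_rank :: "'a set set \<Rightarrow> 'a set \<Rightarrow> nat" where
  "matroid_rank Bs S = Max {card (S \<inter> B) | B. B \<in> Bs}"

(* The bijection f identifies the ground set with the column indices {..<n} (JNF matrices are
   indexed from 0).  "submatrix M UNIV J" keeps all rows and the columns with index in J,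
   in increasing order.  The field is given by its type. *)
definition representable_over ::
    "'f::field itself \<Rightarrow> 'a set \<Rightarrow> 'a set set \<Rightarrow> bool" where
  "representable_over _ E Bs \<longleftrightarrow>
     (\<exists>r n f. \<exists>M \<in> (carrier_mat r n :: 'f mat set).
        bij_betw f E {..<n} \<and>
        (\<forall>B \<subseteq> E. B \<in> Bs \<longleftrightarrow>
           square_mat (submatrix M UNIV (f ` B)) \<and> det (submatrix M UNIV (f ` B)) \<noteq> 0))"

end

theory Submission
  imports Defs
begin

text \<open>
  Fix a representation and consider the \<open>2r \<times> 2r\<close> matrix whose columns are indexed by the elements
  of \<open>A\<close> followed by those of \<open>B\<close>; the column of \<open>x\<close> is \<open>(\<alpha>\<^sub>x v\<^sub>x, \<gamma>\<^sub>x v\<^sub>x)\<close>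
  with \<open>\<alpha>\<^sub>x, \<gamma>\<^sub>x \<in> {0, 1, s}\<close>. Expanding its determinant \<open>p(s)\<close> along columns gives
  \<open>p(s) = \<Sum> s\<^bsup>|U|\<^esup> \<delta>(U, V)\<close> over all \<open>U \<supseteq> X\<close>, \<open>V \<supseteq> Y\<close>, where
  \<open>\<delta>(U, V) \<noteq> 0\<close> iff both exchanged sets are bases. Put \<open>\<rho> = r(X \<union> Y)\<close> and
  \<open>d = |A - B|\<close>. Subtracting the upper half of the rows from the lower one and setting \<open>s = 1\<close> leaves
  in the lower half only multiples of the vectors of \<open>X \<union> Y \<union> (A \<inter> B)\<close>, whose rank is at most
  \<open>\<rho> + |A \<inter> B| = r - (d - \<rho>)\<close>, so
  \<open>(s - 1)\<^bsup>d - \<rho>\<^esup>\<close> divides \<open>p\<close>. If \<open>A\<close> or \<open>B\<close> were not a basis, the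
  coefficient of \<open>s\<^bsup>d\<^esup>\<close> would vanish and, by uniqueness of the pair, \<open>p\<close> would be a nonzero
  polynomial with at most \<open>d - \<rho>\<close> terms. In characteristic zero such a polynomial is not divisible
  by \<open>(s - 1)\<^bsup>d - \<rho>\<^esup>\<close>.
\<close>

section \<open>Polynomials with few terms and their multiplicity at 1\<close>

lemma sparse_poly_eq_0:
  fixes p :: "'f::field_char_0 poly"
  assumes "[:-1, 1:] ^ m dvd p" and "card {i. coeff p i \<noteq> 0} \<le> m"
  shows "p = 0"
  using assms
proof (induction m arbitrary: p)
  case 0
  have "finite {i. coeff p i \<noteq> 0}"
    using MOST_coeff_eq_0[of p] by (simp add: eventually_cofinite)
  with 0 show ?case by (auto simp: poly_eq_iff)
next
  case (Suc m)
  show ?case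
  proof (rule ccontr)
    assume "p \<noteq> 0"
    then obtain j where j: "coeff p j \<noteq> 0"
      by (auto simp: poly_eq_iff)
    \<comment> \<open>The operator \<open>x d/dx - j\<close> kills exactly the term of degree \<open>j\<close> and lowers the multiplicity
      of the root \<open>1\<close> by at most one.\<close>
    define q where "q = pCons 0 (pderiv p) - smult (of_nat j) p"
    have coeff_q: "coeff q i = (of_nat i - of_nat j) * coeff p i" for i
      by (cases i) (simp_all add: q_def coeff_pderiv algebra_simps)
    have supp: "{i. coeff q i \<noteq> 0} = {i. coeff p i \<noteq> 0} - {j}"
      by (auto simp: coeff_q)
    have "finite {i. coeff p i \<noteq> 0}"
      using MOST_coeff_eq_0[of p] by (simp add: eventually_cofinite)
    then have "card {i. coeff q i \<noteq> 0} \<le> m"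
      using Suc.prems(2) j unfolding supp by (simp add: card_Diff_singleton)
    moreover have "[:-1, 1:] ^ m dvd q"
    proof -
      obtain u where u: "p = [:-1, 1:] ^ Suc m * u"
        using Suc.prems(1) by (auto elim: dvdE)
      have "[:-1, 1:] ^ m dvd pderiv p"
        unfolding u pderiv_mult pderiv_power_Suc
        by (intro dvd_add) (simp_all add: mult.assoc dvd_smult dvd_mult2 del: mult_pCons_left)
      then have "[:-1, 1:] ^ m dvd [:0, 1:] * pderiv p"
        by (rule dvd_mult)
      moreover have "[:-1, 1:] ^ m dvd p"
        using Suc.prems(1) by (rule dvd_trans[OF le_imp_power_dvd, rotated]) simp
      ultimately show ?thesis
        unfolding q_def by (intro dvd_diff dvd_smult) simp_all
    qed
    ultimately have "q = 0" by (intro Suc.IH)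
    \<comment> \<open>Characteristic zero enters here and in \<open>supp\<close>:
      \<open>of_nat i - of_nat j\<close> is nonzero for distinct \<open>i\<close> and
      \<open>j\<close>. So \<open>q = 0\<close> leaves \<open>p\<close> a single monomial, whose
      value at 1 is its coefficient.\<close>
    then have "coeff p i = 0" if "i \<noteq> j" for i
      using coeff_q[of i] that by simp
    then have p: "p = monom (coeff p j) j"
      by (auto simp: poly_eq_iff)
    have "[:-1, 1:] dvd p"
      using Suc.prems(1) by (rule dvd_trans[rotated]) (unfold power_Suc, rule dvd_triv_left)
    then have "poly p 1 = 0"
      by (auto simp: dvd_def)
    then have "coeff p j = 0"
      by (subst (asm) p) (simp add: poly_monom)
    with j show False by simp
  qed
qed

section \<open>Determinants: divisible rows and expansion along columns\<close>

text \<open>Each Leibniz term contains one entry from every row, so each row in \<open>K\<close>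
  contributes a factor \<open>q\<close>.\<close>

lemma power_dvd_det:
  fixes M :: "'a::comm_ring_1 mat"
  assumes M: "M \<in> carrier_mat n n" and K: "K \<subseteq> {0..<n}"
    and dvd: "\<And>k i. k \<in> K \<Longrightarrow> i < n \<Longrightarrow> q dvd M $$ (k, i)"
  shows "q ^ card K dvd det M"
  unfolding det_def'[OF M]
proof (intro dvd_sum dvd_mult)
  fix p assume "p \<in> {p. p permutes {0..<n}}"
  then have p: "p k < n" if "k \<in> K" for k
    using permutes_in_image[of p "{0..<n}" k] that K by auto
  have "q ^ card K = (\<Prod>k\<in>K. q)" by simp
  also have "\<dots> dvd (\<Prod>k = 0..<n. M $$ (k, p k))"
    using K dvd p by (intro prod_dvd_prod_subset2) auto
  finally show "q ^ card K dvd (\<Prod>k = 0..<n. M $$ (k, p k))" .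
qed

text \<open>Multilinearity in the columns: \<open>T\<close> collects the columns that choose their
  \<open>w\<close> part. The Leibniz products run over columns here, so that each product of sums
  distributes over the subsets \<open>T\<close>.\<close>

lemma det_expand_columns:
  fixes w z :: "nat \<Rightarrow> nat \<Rightarrow> 'a::comm_ring_1"
  shows "det (mat n n (\<lambda>(k, i). a i * w k i + c i * z k i)) =
    (\<Sum>T\<in>Pow {0..<n}. prod a T * prod c ({0..<n} - T) *
       det (mat n n (\<lambda>(k, i). if i \<in> T then w k i else z k i)))"
    (is "det ?M = (\<Sum>T\<in>_. _ * det (?N T))")
proof -
  let ?P = "{p. p permutes {0..<n}}"
  have less: "p i < n" if "p permutes {0..<n}" "i < n" for p i
    using permutes_in_image[OF that(1), of i] that(2) by simp
  have "det ?M = (\<Sum>p\<in>?P. signof p * (\<Prod>i = 0..<n. a i * w (p i) i + c i * z (p i) i))"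
    by (subst mat_det_left_def[of _ n]) (auto intro!: sum.cong prod.cong simp: less)
  also have "\<dots> = (\<Sum>p\<in>?P. \<Sum>T\<in>Pow {0..<n}. prod a T * prod c ({0..<n} - T) *
      (signof p * ((\<Prod>i\<in>T. w (p i) i) * (\<Prod>i\<in>{0..<n} - T. z (p i) i))))"
    by (simp add: prod_add prod.distrib sum_distrib_left mult_ac)
  also have "\<dots> = (\<Sum>T\<in>Pow {0..<n}. prod a T * prod c ({0..<n} - T) *
      (\<Sum>p\<in>?P. signof p * ((\<Prod>i\<in>T. w (p i) i) * (\<Prod>i\<in>{0..<n} - T. z (p i) i))))"
    by (subst sum.swap) (simp add: sum_distrib_left)
  also have "\<dots> = (\<Sum>T\<in>Pow {0..<n}. prod a T * prod c ({0..<n} - T) * det (?N T))"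
  proof (intro sum.cong refl arg_cong2[where f = "(*)"])
    fix T assume T: "T \<in> Pow {0..<n}"
    have eq: "(\<Prod>i\<in>T. w (p i) i) * (\<Prod>i\<in>{0..<n} - T. z (p i) i) =
        (\<Prod>i = 0..<n. ?N T $$ (p i, i))" if "p permutes {0..<n}" for p
    proof -
      have "(\<Prod>i = 0..<n. ?N T $$ (p i, i)) = (\<Prod>i = 0..<n. if i \<in> T then w (p i) i else z (p i) i)"
        using less[OF that] by (intro prod.cong) auto
      also have "\<dots> = (\<Prod>i\<in>T. w (p i) i) * (\<Prod>i\<in>{0..<n} - T. z (p i) i)"
        using T by (subst prod.If_cases) (auto intro!: arg_cong2[where f = "(*)"] prod.cong)
      finally show ?thesis by simp
    qed
    show "(\<Sum>p\<in>?P. signof p * ((\<Prod>i\<in>T. w (p i) i) * (\<Prod>i\<in>{0..<n} - T. z (p i) i))) = det (?N T)"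
      by (subst mat_det_left_def[of _ n]) (auto intro!: sum.cong simp: eq)
  qed
  finally show ?thesis .
qed

section \<open>Linear independence of indexed vectors\<close>

text \<open>The vectors form an indexed family, so two elements with the same vector are dependent.
  Infinite sums default to 0, so no infinite set is independent.\<close>

definition lin_indep :: "nat \<Rightarrow> ('a \<Rightarrow> nat \<Rightarrow> 'f::field) \<Rightarrow> 'a set \<Rightarrow> bool" where
  "lin_indep r g S \<longleftrightarrow> (\<forall>c. (\<forall>k<r. (\<Sum>x\<in>S. c x * g x k) = 0) \<longrightarrow> (\<forall>x\<in>S. c x = 0))"

lemma lin_indepD:
  "lin_indep r g S \<Longrightarrow> (\<And>k. k < r \<Longrightarrow> (\<Sum>x\<in>S. c x * g x k) = 0) \<Longrightarrow> x \<in> S \<Longrightarrow> c x = 0"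
  unfolding lin_indep_def by blast

lemma lin_indepI:
  assumes "\<And>c x. (\<And>k. k < r \<Longrightarrow> (\<Sum>x\<in>S. c x * g x k) = 0) \<Longrightarrow> x \<in> S \<Longrightarrow> c x = 0"
  shows "lin_indep r g S"
  using assms unfolding lin_indep_def by blast

lemma lin_indep_image:
  assumes "inj_on e T"
  shows "lin_indep r g (e ` T) \<longleftrightarrow> lin_indep r (\<lambda>i. g (e i)) T"
proof
  assume L: "lin_indep r g (e ` T)"
  show "lin_indep r (\<lambda>i. g (e i)) T"
  proof (rule lin_indepI)
    fix c i assume *: "\<And>k. k < r \<Longrightarrow> (\<Sum>i\<in>T. c i * g (e i) k) = 0" and i: "i \<in> T"
    have "(\<Sum>x\<in>e ` T. c (the_inv_into T e x) * g x k) = 0" if "k < r" for k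
      using *[OF that] by (simp add: sum.reindex[OF assms] the_inv_into_f_f[OF assms])
    then have "c (the_inv_into T e (e i)) = 0"
      using i by (intro lin_indepD[OF L, of "\<lambda>x. c (the_inv_into T e x)"]) auto
    then show "c i = 0" using i by (simp add: the_inv_into_f_f[OF assms])
  qed
next
  assume L: "lin_indep r (\<lambda>i. g (e i)) T"
  show "lin_indep r g (e ` T)"
  proof (rule lin_indepI)
    fix c x assume *: "\<And>k. k < r \<Longrightarrow> (\<Sum>x\<in>e ` T. c x * g x k) = 0" and "x \<in> e ` T"
    then obtain i where i: "i \<in> T" "x = e i" by blast
    have "c (e i) = 0"
      using i(1) * by (intro lin_indepD[OF L, of "\<lambda>i. c (e i)"]) (simp_all add: sum.reindex[OF assms])
    then show "c x = 0" using i by simp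
  qed
qed

lemma det_nonzero_iff_lin_indep:
  fixes g :: "nat \<Rightarrow> nat \<Rightarrow> 'f::field"
  shows "det (mat n n (\<lambda>(k, i). g i k)) \<noteq> 0 \<longleftrightarrow> lin_indep n g {0..<n}"
    (is "det ?M \<noteq> 0 \<longleftrightarrow> _")
proof -
  have mult: "(?M *\<^sub>v v) $ k = (\<Sum>i\<in>{0..<n}. v $ i * g i k)"
    if "v \<in> carrier_vec n" "k < n" for v k
    using that by (auto simp: scalar_prod_def mult.commute intro!: sum.cong)
  have iff: "det ?M = 0 \<longleftrightarrow> (\<exists>v. v \<in> carrier_vec n \<and> v \<noteq> 0\<^sub>v n \<and> ?M *\<^sub>v v = 0\<^sub>v n)"
    by (rule det_0_iff_vec_prod_zero) simp
  show ?thesis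
  proof
    assume nz: "det ?M \<noteq> 0"
    show "lin_indep n g {0..<n}"
    proof (rule lin_indepI)
      fix c i assume c: "\<And>k. k < n \<Longrightarrow> (\<Sum>i\<in>{0..<n}. c i * g i k) = 0" and i: "i \<in> {0..<n}"
      have "?M *\<^sub>v vec n c = 0\<^sub>v n"
        by (rule eq_vecI) (simp_all add: mult c del: index_mult_mat_vec)
      then have "vec n c = 0\<^sub>v n" using nz iff by (metis vec_carrier)
      then show "c i = 0" using i by (metis atLeastLessThan_iff index_vec index_zero_vec(1))
    qed
  next
    assume L: "lin_indep n g {0..<n}"
    show "det ?M \<noteq> 0"
      unfolding iff
    proof (safe)
      fix v assume v: "v \<in> carrier_vec n" "v \<noteq> 0\<^sub>v n" "?M *\<^sub>v v = 0\<^sub>v n"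
      have "v $ i = 0" if "i < n" for i
        using that v mult[OF v(1)] by (intro lin_indepD[OF L, of "\<lambda>i. v $ i"]) (auto simp del: index_mult_mat_vec)
      then have "v = 0\<^sub>v n" using v(1) by auto
      with v(2) show False by simp
    qed
  qed
qed

text \<open>If \<open>card S\<close> exceeded \<open>r\<close>, padding the vectors with zero
  coordinates would give a square matrix with independent columns but a zero row.\<close>

lemma lin_indep_card_le:
  assumes "lin_indep r g S" and "finite S"
  shows "card S \<le> r"
proof (rule ccontr)
  assume "\<not> card S \<le> r"
  then have n: "r < card S" by simp
  let ?n = "card S"
  obtain e where e: "bij_betw e {0..<?n} S"
    using ex_bij_betw_nat_finite[OF assms(2)] by blast
  let ?g = "\<lambda>i k. if k < r then g (e i) k else 0"
  let ?M = "mat ?n ?n (\<lambda>(k, i). ?g i k)"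
  \<comment> \<open>Row \<open>r\<close> is one of the padded zero rows, so the divisibility lemma
    applies with \<open>q = 0\<close>.\<close>
  have "(0::'b) ^ card {r} dvd det ?M"
    using n by (intro power_dvd_det[of _ ?n]) auto
  then have "det ?M = 0" by simp
  then have "\<not> lin_indep ?n ?g {0..<?n}"
    unfolding det_nonzero_iff_lin_indep[of ?n ?g, symmetric] by simp
  moreover have "lin_indep r (\<lambda>i. g (e i)) {0..<?n}"
    using lin_indep_image[of e "{0..<?n}" r g] e assms(1) by (simp add: bij_betw_def)
  then have "lin_indep ?n ?g {0..<?n}"
  proof (rule contrapos_pp)
    assume "\<not> lin_indep ?n ?g {0..<?n}"
    then obtain c i where c: "\<forall>k<?n. (\<Sum>i\<in>{0..<?n}. c i * ?g i k) = 0" "i \<in> {0..<?n}" "c i \<noteq> 0"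
      unfolding lin_indep_def by blast
    have "(\<Sum>i\<in>{0..<?n}. c i * g (e i) k) = 0" if "k < r" for k
      using c(1)[rule_format, of k] that n by simp
    with c(2,3) show "\<not> lin_indep r (\<lambda>i. g (e i)) {0..<?n}"
      unfolding lin_indep_def by blast
  qed
  ultimately show False by blast
qed

section \<open>From representing matrices to adapted coordinates\<close>

lemma bij_betw_pick: "bij_betw (pick J) {0..<card J} J" if "finite J"
proof -
  have inj: "inj_on (pick J) {0..<card J}"
    by (rule linorder_inj_onI') (use pick_mono_le[of _ J] in \<open>fastforce\<close>)
  moreover have "pick J ` {0..<card J} \<subseteq> J"
    using pick_in_set_le[of _ J] by auto
  ultimately show ?thesis
    using that card_subset_eq[OF that, of "pick J ` {0..<card J}"]
    by (simp add: bij_betw_def card_image)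
qed

text \<open>Whether a determinant vanishes does not depend on the order of its columns, so the order
  imposed by \<open>submatrix\<close> can be forgotten; squareness becomes
  \<open>card S = r\<close>.\<close>

lemma representable_lin_indep:
  fixes E :: "'a set"
  assumes rep: "representable_over TYPE('f::field) E Bs"
  obtains r and g :: "'a \<Rightarrow> nat \<Rightarrow> 'f::field"
  where "\<And>S. S \<subseteq> E \<Longrightarrow> S \<in> Bs \<longleftrightarrow> card S = r \<and> lin_indep r g S"
proof -
  obtain r n f and M :: "'f mat" where M: "M \<in> carrier_mat r n"
    and f: "bij_betw f E {..<n}"
    and Bs: "\<forall>S \<subseteq> E. S \<in> Bs \<longleftrightarrow>
      square_mat (submatrix M UNIV (f ` S)) \<and> det (submatrix M UNIV (f ` S)) \<noteq> 0"
    using rep unfolding representable_over_def by blast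
  let ?g = "\<lambda>x k. M $$ (k, f x)"
  have "S \<in> Bs \<longleftrightarrow> card S = r \<and> lin_indep r ?g S" if S: "S \<subseteq> E" for S
  proof -
    let ?J = "f ` S" and ?N = "submatrix M UNIV (f ` S)"
    have J: "?J \<subseteq> {..<n}" using S f by (auto simp: bij_betw_def)
    have fS: "inj_on f S" using S f by (auto simp: bij_betw_def intro: inj_on_subset)
    have cardJ: "card {j. j < n \<and> j \<in> ?J} = card S"
      using J by (subst card_image[OF fS, symmetric]) (auto intro!: arg_cong[where f = card])
    have dims: "dim_row ?N = r" "dim_col ?N = card S"
      using M cardJ by (simp_all add: dim_submatrix)
    show ?thesis
    proof (cases "card S = r")
      case False
      then show ?thesis using Bs S dims by auto
    next
      case True
      \<comment> \<open>\<open>?e\<close> enumerates \<open>S\<close> in the order in which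
        \<open>submatrix\<close> lists its columns.\<close>
      let ?e = "\<lambda>i. the_inv_into S f (pick ?J i)"
      have "bij_betw (pick ?J) {0..<r} ?J"
        using bij_betw_pick[of ?J] finite_subset[OF J] True card_image[OF fS] by simp
      moreover have "bij_betw (the_inv_into S f) ?J S"
        using fS by (intro bij_betw_the_inv_into) (simp add: bij_betw_def)
      ultimately have "bij_betw ?e {0..<r} S"
        by (auto dest: bij_betw_trans simp: comp_def)
      then have e: "inj_on ?e {0..<r}" "?e ` {0..<r} = S"
        by (auto simp: bij_betw_def)
      have pick: "pick ?J i \<in> ?J" if "i < r" for i
        using that True card_image[OF fS] by (intro pick_in_set_le) simp
      have "?N = mat r r (\<lambda>(k, i). ?g (?e i) k)"
        using M True cardJ dims pick
        by (intro eq_matI) (simp_all add: submatrix_index pick_UNIV f_the_inv_into_f[OF fS])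
      then have "det ?N \<noteq> 0 \<longleftrightarrow> lin_indep r ?g S"
        using det_nonzero_iff_lin_indep[of r "\<lambda>i. ?g (?e i)"] lin_indep_image[OF e(1), of r ?g] e(2)
        by simp
      then show ?thesis using Bs S dims True by auto
    qed
  qed
  then show thesis by (rule that)
qed

text \<open>Multiplying all vectors by the inverse of the matrix with columns \<open>B\<close>
  preserves linear relations and makes \<open>B\<close> the standard basis.\<close>

lemma lin_indep_coordinates:
  fixes g :: "'a \<Rightarrow> nat \<Rightarrow> 'f::field"
  assumes "lin_indep r g B" and "card B = r" and "finite B"
  obtains b and h :: "'a \<Rightarrow> nat \<Rightarrow> 'f" where "bij_betw b {0..<r} B"
    and "\<And>k l. k < r \<Longrightarrow> l < r \<Longrightarrow> h (b l) k = (if k = l then 1 else 0)"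
    and "\<And>S. lin_indep r h S \<longleftrightarrow> lin_indep r g S"
proof -
  obtain b where b: "bij_betw b {0..<r} B"
    using ex_bij_betw_nat_finite[OF assms(3)] assms(2) by blast
  have L: "lin_indep r (\<lambda>l. g (b l)) {0..<r}"
    using lin_indep_image[of b "{0..<r}" r g] b assms(1) by (simp add: bij_betw_def)
  define M where "M = mat r r (\<lambda>(k, l). g (b l) k)"
  have M: "M \<in> carrier_mat r r" by (simp add: M_def)
  have "det M \<noteq> 0"
    unfolding M_def using L det_nonzero_iff_lin_indep[of r "\<lambda>l. g (b l)"] by simp
  then obtain N where N: "N \<in> carrier_mat r r" "M * N = 1\<^sub>m r"
    using det_non_zero_imp_unit[OF M] by (fastforce simp: Units_def ring_mat_def)
  define h where "h x l = (N *\<^sub>v vec r (g x)) $ l" for x l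
  have g: "g x k = (\<Sum>l\<in>{0..<r}. h x l * g (b l) k)" if "k < r" for x k
  proof -
    have "M *\<^sub>v (N *\<^sub>v vec r (g x)) = vec r (g x)"
      using assoc_mult_mat_vec[OF M N(1), of "vec r (g x)"] N(2) by simp
    then have "g x k = (M *\<^sub>v (N *\<^sub>v vec r (g x))) $ k"
      using that by simp
    also have "\<dots> = (\<Sum>l\<in>{0..<r}. h x l * g (b l) k)"
      using that N(1) unfolding h_def M_def
      by (auto simp: scalar_prod_def mult.commute intro!: sum.cong)
    finally show ?thesis .
  qed
  have delta: "h (b l) k = (if k = l then 1 else 0)" if "k < r" "l < r" for k l
  proof -
    have "h (b l) k - (if k = l then 1 else 0) = 0"
    proof (rule lin_indepD[OF L, of "\<lambda>i. h (b l) i - (if i = l then 1 else 0)"])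
      fix m assume m: "m < r"
      have "(\<Sum>i\<in>{0..<r}. (if i = l then 1 else 0) * g (b i) m) = g (b l) m"
        using that by (simp add: if_distrib[of "\<lambda>x. x * _"] cong: if_cong)
      then show "(\<Sum>i\<in>{0..<r}. (h (b l) i - (if i = l then 1 else 0)) * g (b i) m) = 0"
        using g[OF m, of "b l"] by (simp add: left_diff_distrib sum_subtractf)
    qed (use that in simp)
    then show ?thesis by simp
  qed
  \<comment> \<open>A combination of the \<open>g\<close> vectors has the same combination of the
    \<open>h\<close> vectors as its coordinates, so one vanishes iff the other does.\<close>
  have comb: "(\<Sum>x\<in>S. c x * g x k) = (\<Sum>l\<in>{0..<r}. (\<Sum>x\<in>S. c x * h x l) * g (b l) k)"
    if "k < r" for c k S
  proof -
    have "(\<Sum>x\<in>S. c x * g x k) = (\<Sum>x\<in>S. \<Sum>l\<in>{0..<r}. c x * h x l * g (b l) k)"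
      by (rule sum.cong[OF refl], subst g[OF that]) (simp add: sum_distrib_left mult.assoc)
    then show ?thesis by (subst (asm) sum.swap) (simp add: sum_distrib_right)
  qed
  have iff: "(\<forall>k<r. (\<Sum>x\<in>S. c x * g x k) = 0) \<longleftrightarrow> (\<forall>k<r. (\<Sum>x\<in>S. c x * h x k) = 0)" for c S
  proof
    assume *: "\<forall>k<r. (\<Sum>x\<in>S. c x * g x k) = 0"
    show "\<forall>k<r. (\<Sum>x\<in>S. c x * h x k) = 0"
    proof (intro allI impI)
      fix l assume "l < r"
      then show "(\<Sum>x\<in>S. c x * h x l) = 0"
        using * comb[of _ c S] by (intro lin_indepD[OF L, of "\<lambda>l. \<Sum>x\<in>S. c x * h x l"]) auto
    qed
  qed (simp add: comb)
  show thesis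
    using b delta iff by (intro that[of b h]) (simp_all add: lin_indep_def)
qed

text \<open>Turns a rank deficiency of \<open>W\<close> into coordinates that vanish on all of
  \<open>W\<close>. \<open>B0\<close> is part of the conclusion because
  \<open>card (B0 \<inter> W)\<close> is what gets compared with ranks later.\<close>

lemma adapted_representation:
  fixes g :: "'a \<Rightarrow> nat \<Rightarrow> 'f::field"
  assumes "finite E" and "Bs \<subseteq> Pow E" and "Bs \<noteq> {}"
    and rep: "\<And>S. S \<subseteq> E \<Longrightarrow> S \<in> Bs \<longleftrightarrow> card S = r \<and> lin_indep r g S"
    and W: "W \<subseteq> E"
  obtains B0 K and h :: "'a \<Rightarrow> nat \<Rightarrow> 'f" where "B0 \<in> Bs"
    and "\<And>S. S \<subseteq> E \<Longrightarrow> S \<in> Bs \<longleftrightarrow> card S = r \<and> lin_indep r h S"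
    and "K \<subseteq> {0..<r}" and "card K = r - card (B0 \<inter> W)"
    and "\<And>k x. k \<in> K \<Longrightarrow> x \<in> W \<Longrightarrow> h x k = 0"
proof -
  have "finite Bs" using assms(1,2) by (meson finite_Pow_iff finite_subset)
  \<comment> \<open>In coordinates with respect to a basis \<open>B0\<close> meeting \<open>W\<close> maximally, a nonzero coordinate of
    \<open>x \<in> W\<close> at some element outside \<open>W\<close> would allow exchanging that element for \<open>x\<close>.\<close>
  then have "\<exists>B0\<in>Bs. \<forall>S\<in>Bs. card (S \<inter> W) \<le> card (B0 \<inter> W)"
    using Max_in[of "(\<lambda>S. card (S \<inter> W)) ` Bs"] Max_ge[of "(\<lambda>S. card (S \<inter> W)) ` Bs"] assms(3)
    by fastforce
  then obtain B0 where B0: "B0 \<in> Bs" and max: "\<And>S. S \<in> Bs \<Longrightarrow> card (S \<inter> W) \<le> card (B0 \<inter> W)"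
    by blast
  have B0E: "B0 \<subseteq> E" and fB0: "finite B0"
    using B0 assms(1,2) by (auto intro: finite_subset)
  then have "lin_indep r g B0" "card B0 = r" using rep B0 by auto
  then obtain b and h :: "'a \<Rightarrow> nat \<Rightarrow> 'f" where b: "bij_betw b {0..<r} B0"
    and delta: "\<And>k l. k < r \<Longrightarrow> l < r \<Longrightarrow> h (b l) k = (if k = l then 1 else 0)"
    and iff: "\<And>S. lin_indep r h S \<longleftrightarrow> lin_indep r g S"
    using lin_indep_coordinates fB0 by blast
  define K where "K = {k \<in> {0..<r}. b k \<notin> W}"
  have bK: "b ` K = B0 - W" and injK: "inj_on b K"
    using b by (auto simp: K_def bij_betw_def inj_on_def)
  have "card K = card (B0 - W)" using card_image[OF injK] bK by simp
  also have "\<dots> = r - card (B0 \<inter> W)"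
    using \<open>card B0 = r\<close> fB0 by (simp add: card_Diff_subset_Int)
  finally have cardK: "card K = r - card (B0 \<inter> W)" .
  have "h x k = 0" if k: "k \<in> K" and x: "x \<in> W" for k x
  proof (rule ccontr)
    assume nz: "h x k \<noteq> 0"
    have kr: "k < r" and bk: "b k \<notin> W" "b k \<in> B0"
      using k b by (auto simp: K_def bij_betw_def)
    have xB0: "x \<notin> B0"
    proof
      assume "x \<in> B0"
      then obtain l where "l < r" "x = b l" using b by (auto simp: bij_betw_def)
      then show False using delta[OF kr] nz bk x by (auto split: if_splits)
    qed
    let ?S = "insert x (B0 - {b k})"
    have "lin_indep r h ?S"
    proof (rule lin_indepI)
      fix c y assume *: "\<And>m. m < r \<Longrightarrow> (\<Sum>y\<in>?S. c y * h y m) = 0" and y: "y \<in> ?S"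
      \<comment> \<open>The elements of \<open>B0\<close> are unit vectors, so coordinate
        \<open>k\<close> sees only \<open>x\<close>, and \<open>c x = 0\<close> because
        \<open>h x k\<close> is nonzero. Every other coordinate then isolates one remaining
        coefficient.\<close>
      have sum: "(\<Sum>y\<in>?S. c y * h y m) = c x * h x m + (if m = k then 0 else c (b m))"
        if m: "m < r" for m
      proof -
        have "(\<Sum>y\<in>B0 - {b k}. c y * h y m) = (\<Sum>l\<in>{0..<r} - {k}. c (b l) * h (b l) m)"
          using b kr by (intro sum.reindex_bij_betw[symmetric] bij_betw_DiffI) (auto simp: bij_betw_def)
        also have "\<dots> = (\<Sum>l\<in>{0..<r} - {k}. if m = l then c (b l) else 0)"
          using m by (intro sum.cong) (auto simp: delta)
        also have "\<dots> = (if m = k then 0 else c (b m))"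
          using m by simp
        finally show ?thesis using xB0 fB0 by simp
      qed
      have cx: "c x = 0" using sum[OF kr] *[OF kr] nz by simp
      show "c y = 0"
      proof (cases "y = x")
        case False
        then obtain l where l: "l < r" "y = b l" using y b by (auto simp: bij_betw_def)
        moreover have "l \<noteq> k" using False y l by auto
        ultimately show ?thesis using sum[OF l(1)] *[OF l(1)] cx by simp
      qed (use cx in simp)
    qed
    moreover have "card ?S = r"
      using xB0 fB0 bk \<open>card B0 = r\<close> card_Suc_Diff1[of B0 "b k"] by simp
    moreover have "?S \<subseteq> E" using x W B0E by auto
    ultimately have "?S \<in> Bs" using rep iff by blast
    moreover have "?S \<inter> W = insert x (B0 \<inter> W)" using x bk by auto
    ultimately show False using max[of ?S] xB0 fB0 by simp
  qed
  then show thesis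
    using B0 cardK rep iff by (intro that[of B0 h K]) (auto simp: K_def)
qed

section \<open>The determinant polynomial of the exchanges between A and B\<close>

lemma det_const_poly:
  fixes m :: "nat \<Rightarrow> nat \<Rightarrow> 'f::comm_ring_1"
  shows "det (mat n n (\<lambda>(k, i). [:m k i:])) = [:det (mat n n (\<lambda>(k, i). m k i)):]"
proof -
  interpret comm_ring_hom "\<lambda>x::'f. [:x:]"
    by unfold_locales (simp_all add: one_pCons)
  have "mat n n (\<lambda>(k, i). [:m k i:]) = map_mat (\<lambda>x. [:x:]) (mat n n (\<lambda>(k, i). m k i))"
    by (rule eq_matI) auto
  then show ?thesis by simp
qed

text \<open>Adding the upper rows to the lower ones turns the columns \<open>(u, -u)\<close> and
  \<open>(0, u)\<close> into \<open>(u, 0)\<close> and \<open>(0, u)\<close>, so a linear relation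
  splits into one on \<open>T\<close> and one on its complement.\<close>

lemma det_block_nonzero_iff:
  fixes u :: "nat \<Rightarrow> nat \<Rightarrow> 'f::field"
  assumes T: "T \<subseteq> {0..<2 * r}"
  shows "det (mat (2 * r) (2 * r) (\<lambda>(k, i).
      if i \<in> T then (if k < r then u i k else - u i (k - r))
      else (if k < r then 0 else u i (k - r)))) \<noteq> 0 \<longleftrightarrow>
    lin_indep r u T \<and> lin_indep r u ({0..<2 * r} - T)"
proof -
  let ?I = "{0..<2 * r}"
  let ?v = "\<lambda>i k. if i \<in> T then (if k < r then u i k else - u i (k - r))
      else (if k < r then 0 else u i (k - r))"
  have split: "(\<Sum>i\<in>?I. c i * ?v i k) = (\<Sum>i\<in>T. c i * ?v i k) + (\<Sum>i\<in>?I - T. c i * ?v i k)" for c k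
    using T by (subst add.commute, intro sum.subset_diff) auto
  have top: "(\<Sum>i\<in>?I. c i * ?v i k) = (\<Sum>i\<in>T. c i * u i k)" if "k < r" for c k
    unfolding split using that by simp
  have bot: "(\<Sum>i\<in>?I. c i * ?v i (r + k)) = (\<Sum>i\<in>?I - T. c i * u i k) - (\<Sum>i\<in>T. c i * u i k)" for c k
    unfolding split by (simp add: sum_negf)
  have iff: "(\<forall>k<2 * r. (\<Sum>i\<in>?I. c i * ?v i k) = 0) \<longleftrightarrow>
      (\<forall>k<r. (\<Sum>i\<in>T. c i * u i k) = 0) \<and> (\<forall>k<r. (\<Sum>i\<in>?I - T. c i * u i k) = 0)" (is "?L c \<longleftrightarrow> ?R c") for c
  proof
    assume L: "?L c"
    have t: "(\<Sum>i\<in>T. c i * u i k) = 0" if "k < r" for k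
      using L[rule_format, of k] top[OF that, of c] that by simp
    have "(\<Sum>i\<in>?I - T. c i * u i k) = 0" if "k < r" for k
      using L[rule_format, of "r + k"] bot[of c k] t[OF that] that by simp
    with t show "?R c" by blast
  next
    assume R: "?R c"
    show "?L c"
    proof (intro allI impI)
      fix k assume k: "k < 2 * r"
      show "(\<Sum>i\<in>?I. c i * ?v i k) = 0"
      proof (cases "k < r")
        case True
        then show ?thesis using top[OF True, of c] R by simp
      next
        case False
        then have "r + (k - r) = k" "k - r < r" using k by auto
        then show ?thesis using bot[of c "k - r"] R by (simp only: diff_self)
      qed
    qed
  qed
  have "lin_indep (2 * r) ?v ?I \<longleftrightarrow> lin_indep r u T \<and> lin_indep r u (?I - T)"
  proof (intro iffI conjI lin_indepI)
    fix c i assume L: "lin_indep (2 * r) ?v ?I"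
      and c: "\<And>k. k < r \<Longrightarrow> (\<Sum>i\<in>T. c i * u i k) = 0" and i: "i \<in> T"
    \<comment> \<open>A relation on one part, extended by zero, is a relation on all
      columns.\<close>
    let ?c = "\<lambda>i. if i \<in> T then c i else 0"
    have "?L ?c" unfolding iff using c by simp
    then have "?c i = 0" using i T by (intro lin_indepD[OF L, of ?c]) auto
    then show "c i = 0" using i by simp
  next
    fix c i assume L: "lin_indep (2 * r) ?v ?I"
      and c: "\<And>k. k < r \<Longrightarrow> (\<Sum>i\<in>?I - T. c i * u i k) = 0" and i: "i \<in> ?I - T"
    let ?c = "\<lambda>i. if i \<in> T then 0 else c i"
    have "?L ?c" unfolding iff using c by simp
    then have "?c i = 0" using i by (intro lin_indepD[OF L, of ?c]) auto
    then show "c i = 0" using i by simp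
  next
    fix c i assume R: "lin_indep r u T \<and> lin_indep r u (?I - T)"
      and c: "\<And>k. k < 2 * r \<Longrightarrow> (\<Sum>i\<in>?I. c i * ?v i k) = 0" and i: "i \<in> ?I"
    have "?R c" using c unfolding iff[symmetric] by blast
    then show "c i = 0"
      using R i lin_indepD[of r u T c i] lin_indepD[of r u "?I - T" c i] by blast
  qed
  with det_nonzero_iff_lin_indep[of "2 * r" ?v] show ?thesis by (rule trans)
qed

text \<open>One determinant is read twice: by rows for the divisibility and by columns for the
  coefficients. Only the nonvanishing of \<open>\<delta>\<close> is recorded, because the
  application isolates a single summand and signs do not matter.\<close>

lemma exchange_polynomial:
  fixes g :: "'a \<Rightarrow> nat \<Rightarrow> 'f::field"
  assumes fin: "finite A" "finite B" and card: "card A = r" "card B = r"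
    and X: "X \<subseteq> A - B" and Y: "Y \<subseteq> B - A" and K: "K \<subseteq> {0..<r}"
    and zero: "\<And>k x. k \<in> K \<Longrightarrow> x \<in> X \<union> Y \<union> A \<inter> B \<Longrightarrow> g x k = 0"
  obtains p and \<delta> :: "'a set \<Rightarrow> 'a set \<Rightarrow> 'f"
  where "[:-1, 1:] ^ card K dvd p"
    and "\<And>U V. U \<subseteq> A - B \<Longrightarrow> V \<subseteq> B - A \<Longrightarrow>
      \<delta> U V \<noteq> 0 \<longleftrightarrow> lin_indep r g ((A - U) \<union> V) \<and> lin_indep r g ((B - V) \<union> U)"
    and "\<And>j. coeff p j = (\<Sum>(U, V) | X \<subseteq> U \<and> U \<subseteq> A - B \<and> Y \<subseteq> V \<and> V \<subseteq> B - A \<and> card U = j. \<delta> U V)"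
proof -
  obtain eA where eA: "bij_betw eA {0..<r} A"
    using ex_bij_betw_nat_finite[OF fin(1)] card(1) by blast
  obtain eB where eB: "bij_betw eB {0..<r} B"
    using ex_bij_betw_nat_finite[OF fin(2)] card(2) by blast
  define e where "e i = (if i < r then eA i else eB (i - r))" for i
  let ?I = "{0..<2 * r}"
  have "bij_betw e {0..<r} A"
    using eA by (subst bij_betw_cong[of _ e eA]) (auto simp: e_def)
  then have injA: "inj_on e {0..<r}" and imA: "e ` {0..<r} = A"
    by (auto simp: bij_betw_def)
  have "bij_betw (\<lambda>i. i - r) {r..<2 * r} {0..<r}"
    by (rule bij_betw_byWitness[where f' = "\<lambda>i. i + r"]) auto
  from bij_betw_trans[OF this eB] have "bij_betw e {r..<2 * r} B"
    by (subst bij_betw_cong[of _ e "eB \<circ> (\<lambda>i. i - r)"]) (auto simp: e_def)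
  then have injB: "inj_on e {r..<2 * r}" and imB: "e ` {r..<2 * r} = B"
    by (auto simp: bij_betw_def)
  have eA_in: "e i \<in> A" if "i < r" for i
    using that imA by auto
  have eB_in: "e i \<in> B" if "r \<le> i" "i < 2 * r" for i
    using that imB by auto

  \<comment> \<open>\<open>a i\<close> and \<open>c i\<close> are the weights of column \<open>i\<close> in the upper and lower half, with the upper rows
    already subtracted from the lower ones. Choosing the first weight for \<open>i \<in> T\<close> and the second one
    otherwise corresponds to the exchange in which \<open>U\<close> is the part of \<open>A\<close> outside \<open>T\<close> and \<open>V\<close> the
    part of \<open>B\<close> inside \<open>T\<close>; the zero weights force \<open>X \<subseteq> U \<subseteq> A - B\<close> and \<open>Y \<subseteq> V \<subseteq> B - A\<close>.\<close>
  define a :: "nat \<Rightarrow> 'f poly" where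
    "a i = (if e i \<in> (if i < r then X else A) then 0 else 1)" for i
  define c :: "nat \<Rightarrow> 'f poly" where
    "c i = (if e i \<in> (if i < r then B else Y) then 0 else if i < r then [:0, 1:] else 1)" for i
  define w where "w k i = (if k < r then g (e i) k else - g (e i) (k - r))" for k i
  define z where "z k i = (if k < r then 0 else g (e i) (k - r))" for k i
  define p where "p = det (mat (2 * r) (2 * r) (\<lambda>(k, i). a i * [:w k i:] + c i * [:z k i:]))"
  define D where "D T = det (mat (2 * r) (2 * r) (\<lambda>(k, i). if i \<in> T then w k i else z k i))" for T
  define idx where "idx U V = {i \<in> {0..<r}. e i \<notin> U} \<union> {i \<in> {r..<2 * r}. e i \<in> V}" for U V

  have "[:-1, 1:] ^ card ((\<lambda>k. r + k) ` K) dvd p"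
    unfolding p_def
  proof (rule power_dvd_det)
    fix k i assume "k \<in> (\<lambda>k. r + k) ` K" and i: "i < 2 * r"
    then obtain k' where k': "k' \<in> K" "k = r + k'" "k' < r" using K by auto
    have "a i * [:w k i:] + c i * [:z k i:] = (c i - a i) * [:g (e i) k':]"
      using k' by (simp add: w_def z_def smult_diff_right)
    also have "[:-1, 1:] dvd \<dots>"
    proof (cases "e i \<in> X \<union> Y \<union> A \<inter> B")
      case True
      then show ?thesis using zero[OF k'(1) True] by simp
    next
      case False
      have "c i - a i = (if i < r then [:-1, 1:] else 0)"
      proof (cases "i < r")
        case True
        then show ?thesis using False eA_in[of i] by (simp add: a_def c_def one_pCons)
      next
        case nless: False
        then show ?thesis using False eB_in[of i] i by (simp add: a_def c_def)
      qed
      then have "[:-1, 1:] dvd c i - a i" by simp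
      then show ?thesis by (rule dvd_mult2)
    qed
    finally show "[:-1, 1:] dvd mat (2 * r) (2 * r) (\<lambda>(k, i). a i * [:w k i:] + c i * [:z k i:]) $$ (k, i)"
      using i k' by simp
  qed (use K in auto)
  then have dvd: "[:-1, 1:] ^ card K dvd p"
    by (simp add: card_image)

  have D_nz: "D (idx U V) \<noteq> 0 \<longleftrightarrow> lin_indep r g ((A - U) \<union> V) \<and> lin_indep r g ((B - V) \<union> U)"
    if U: "U \<subseteq> A - B" and V: "V \<subseteq> B - A" for U V
  proof -
    let ?T = "idx U V"
    have "D ?T \<noteq> 0 \<longleftrightarrow> lin_indep r (\<lambda>i. g (e i)) ?T \<and> lin_indep r (\<lambda>i. g (e i)) (?I - ?T)"
      unfolding D_def w_def z_def by (rule det_block_nonzero_iff) (auto simp: idx_def)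
    \<comment> \<open>\<open>e\<close> lists the elements of \<open>A \<inter> B\<close> twice. It
      is injective on \<open>?T\<close> because \<open>V\<close> avoids \<open>A\<close>, and on the
      complement because \<open>U\<close> avoids \<open>B\<close>.\<close>
    moreover have "inj_on e ?T"
    proof (rule inj_onI)
      fix i j assume "i \<in> ?T" "j \<in> ?T" "e i = e j"
      then show "i = j"
        using V eA_in[of i] eA_in[of j] inj_onD[OF injA, of i j] inj_onD[OF injB, of i j]
        by (auto simp: idx_def)
    qed
    moreover have compl: "?I - ?T = {i \<in> {0..<r}. e i \<in> U} \<union> {i \<in> {r..<2 * r}. e i \<notin> V}"
      by (auto simp: idx_def)
    moreover have "inj_on e (?I - ?T)"
    proof (rule inj_onI)
      fix i j assume "i \<in> ?I - ?T" "j \<in> ?I - ?T" "e i = e j"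
      then show "i = j"
        using U eB_in[of i] eB_in[of j] inj_onD[OF injA, of i j] inj_onD[OF injB, of i j]
        unfolding compl by auto
    qed
    moreover have "e ` ?T = (A - U) \<union> V"
      using V unfolding idx_def image_Un imA[symmetric] imB[symmetric] by fastforce
    moreover have "e ` (?I - ?T) = (B - V) \<union> U"
      using U unfolding compl image_Un imA[symmetric] imB[symmetric] by fastforce
    ultimately show ?thesis
      using lin_indep_image[of e ?T r g] lin_indep_image[of e "?I - ?T" r g] by simp
  qed

  define ok where "ok T \<longleftrightarrow> (\<forall>i\<in>T. a i \<noteq> 0) \<and> (\<forall>i\<in>?I - T. c i \<noteq> 0)" for T
  \<comment> \<open>Nonzero values of \<open>a\<close> are 1; nonzero values of \<open>c\<close> are
    the variable on columns of \<open>A\<close> and 1 on columns of \<open>B\<close>. The exponent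
    thus counts the columns of \<open>A\<close> outside \<open>T\<close>, which become
    \<open>U\<close>.\<close>
  have weight: "prod a T * prod c (?I - T) = (if ok T then monom 1 (card ({0..<r} - T)) else 0)"
    if T: "T \<subseteq> ?I" for T
  proof (cases "ok T")
    case True
    have "prod a T = 1"
      using True by (intro prod.neutral) (auto simp: ok_def a_def split: if_splits)
    moreover have "prod c (?I - T) = (\<Prod>i\<in>?I - T. if i < r then [:0, 1:] else 1)"
      using True by (intro prod.cong) (auto simp: ok_def c_def split: if_splits)
    moreover have "\<dots> = (\<Prod>i\<in>{i \<in> ?I - T. i < r}. [:0, 1:])"
      by (rule prod.inter_filter[symmetric]) simp
    moreover have "{i \<in> ?I - T. i < r} = {0..<r} - T" by auto
    ultimately show ?thesis using True by (simp add: monom_altdef)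
  next
    case False
    have "finite T" using T by (rule finite_subset) simp
    with False show ?thesis by (auto simp: ok_def)
  qed
  have "p = (\<Sum>T\<in>Pow ?I. prod a T * prod c (?I - T) * [:D T:])"
    unfolding p_def det_expand_columns D_def det_const_poly[symmetric]
    by (intro sum.cong refl arg_cong2[where f = "(*)"] arg_cong[where f = det] eq_matI) auto
  also have "\<dots> = (\<Sum>T\<in>Pow ?I. if ok T then monom (D T) (card ({0..<r} - T)) else 0)"
    by (intro sum.cong refl) (simp add: weight smult_monom)
  finally have p: "p = \<dots>" .
  have "coeff p j = (\<Sum>(U, V) | X \<subseteq> U \<and> U \<subseteq> A - B \<and> Y \<subseteq> V \<and> V \<subseteq> B - A \<and> card U = j. D (idx U V))" for j
  proof -
    \<comment> \<open>These maps invert \<open>idx\<close> and turn the sum over \<open>T\<close>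
      into a sum over pairs.\<close>
    let ?U = "\<lambda>T. e ` ({0..<r} - T)" and ?V = "\<lambda>T. e ` ({r..<2 * r} \<inter> T)"
    have mem_A: "e i \<in> e ` S \<longleftrightarrow> i \<in> S" if "i \<in> {0..<r}" "S \<subseteq> {0..<r}" for i S
      using inj_on_image_mem_iff[OF injA that] .
    have mem_B: "e i \<in> e ` S \<longleftrightarrow> i \<in> S" if "i \<in> {r..<2 * r}" "S \<subseteq> {r..<2 * r}" for i S
      using inj_on_image_mem_iff[OF injB that] .
    have idx: "idx (?U T) (?V T) = T" if "T \<subseteq> ?I" for T
    proof -
      have "idx (?U T) (?V T) = {i \<in> {0..<r}. i \<notin> {0..<r} - T} \<union> {i \<in> {r..<2 * r}. i \<in> {r..<2 * r} \<inter> T}"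
        unfolding idx_def by (intro arg_cong2[where f = "(\<union>)"] Collect_cong conj_cong refl)
          (subst mem_A mem_B; auto)+
      then show ?thesis using that by auto
    qed
    have UV: "?U (idx U V) = U \<and> ?V (idx U V) = V" if "U \<subseteq> A" "V \<subseteq> B" for U V
    proof -
      have "{0..<r} - idx U V = {i \<in> {0..<r}. e i \<in> U}"
        "{r..<2 * r} \<inter> idx U V = {i \<in> {r..<2 * r}. e i \<in> V}"
        by (auto simp: idx_def)
      moreover have "e ` {i \<in> {0..<r}. e i \<in> U} = U" "e ` {i \<in> {r..<2 * r}. e i \<in> V} = V"
        using that imA imB by blast+
      ultimately show ?thesis by simp
    qed
    have card_U: "card (?U T) = card ({0..<r} - T)" for T
      using injA by (intro card_image) (auto intro: inj_on_subset)
    have ok_iff: "ok T \<longleftrightarrow> X \<subseteq> ?U T \<and> ?U T \<subseteq> A - B \<and> Y \<subseteq> ?V T \<and> ?V T \<subseteq> B - A"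
      if T: "T \<subseteq> ?I" for T
    proof -
      \<comment> \<open>For \<open>U = ?U T\<close> and \<open>V = ?V T\<close> the four conditions
        say, in order, \<open>X \<subseteq> U\<close>, \<open>U \<subseteq> A - B\<close>,
        \<open>Y \<subseteq> V\<close> and \<open>V \<subseteq> B - A\<close>.\<close>
      have "ok T \<longleftrightarrow> (\<forall>i\<in>{0..<r} \<inter> T. e i \<notin> X) \<and> (\<forall>i\<in>{0..<r} - T. e i \<notin> B) \<and>
          (\<forall>i\<in>{r..<2 * r} - T. e i \<notin> Y) \<and> (\<forall>i\<in>{r..<2 * r} \<inter> T. e i \<notin> A)"
      proof -
        have T_eq: "T = {0..<r} \<inter> T \<union> {r..<2 * r} \<inter> T" using T by auto
        have I_eq: "?I - T = ({0..<r} - T) \<union> ({r..<2 * r} - T)" by auto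
        have "(\<forall>i\<in>T. a i \<noteq> 0) \<longleftrightarrow> (\<forall>i\<in>{0..<r} \<inter> T. a i \<noteq> 0) \<and> (\<forall>i\<in>{r..<2 * r} \<inter> T. a i \<noteq> 0)"
          by (subst T_eq) (rule ball_Un)
        then have "ok T \<longleftrightarrow> (\<forall>i\<in>{0..<r} \<inter> T. a i \<noteq> 0) \<and> (\<forall>i\<in>{r..<2 * r} \<inter> T. a i \<noteq> 0) \<and>
            (\<forall>i\<in>{0..<r} - T. c i \<noteq> 0) \<and> (\<forall>i\<in>{r..<2 * r} - T. c i \<noteq> 0)"
          unfolding ok_def I_eq ball_Un by blast
        then show ?thesis by (auto simp: a_def c_def)
      qed
      moreover have "(\<forall>i\<in>{0..<r} \<inter> T. e i \<notin> X) \<longleftrightarrow> X \<subseteq> ?U T"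
      proof
        assume *: "\<forall>i\<in>{0..<r} \<inter> T. e i \<notin> X"
        show "X \<subseteq> ?U T"
        proof
          fix x assume "x \<in> X"
          then obtain i where "i \<in> {0..<r}" "x = e i" using X imA by blast
          then show "x \<in> ?U T" using * \<open>x \<in> X\<close> by blast
        qed
      next
        assume *: "X \<subseteq> ?U T"
        show "\<forall>i\<in>{0..<r} \<inter> T. e i \<notin> X"
          using mem_A[of _ "{0..<r} - T"] * by blast
      qed
      moreover have "(\<forall>i\<in>{r..<2 * r} - T. e i \<notin> Y) \<longleftrightarrow> Y \<subseteq> ?V T"
      proof
        assume *: "\<forall>i\<in>{r..<2 * r} - T. e i \<notin> Y"
        show "Y \<subseteq> ?V T"
        proof
          fix y assume "y \<in> Y"
          then obtain i where "i \<in> {r..<2 * r}" "y = e i" using Y imB by blast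
          then show "y \<in> ?V T" using * \<open>y \<in> Y\<close> by blast
        qed
      next
        assume *: "Y \<subseteq> ?V T"
        show "\<forall>i\<in>{r..<2 * r} - T. e i \<notin> Y"
          using mem_B[of _ "{r..<2 * r} \<inter> T"] * by blast
      qed
      moreover have "(\<forall>i\<in>{0..<r} - T. e i \<notin> B) \<longleftrightarrow> ?U T \<subseteq> A - B"
        using imA by auto
      moreover have "(\<forall>i\<in>{r..<2 * r} \<inter> T. e i \<notin> A) \<longleftrightarrow> ?V T \<subseteq> B - A"
        using imB by auto
      ultimately show ?thesis by blast
    qed
    have "coeff p j = (\<Sum>T\<in>Pow ?I. if ok T \<and> card ({0..<r} - T) = j then D T else 0)"
      unfolding p coeff_sum by (intro sum.cong) auto
    also have "\<dots> = (\<Sum>T\<in>{T \<in> Pow ?I. ok T \<and> card ({0..<r} - T) = j}. D T)"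
      by (rule sum.inter_filter[symmetric]) simp
    also have "\<dots> = (\<Sum>(U, V) | X \<subseteq> U \<and> U \<subseteq> A - B \<and> Y \<subseteq> V \<and> V \<subseteq> B - A \<and> card U = j. D (idx U V))"
    proof (rule sum.reindex_bij_witness[where i = "\<lambda>(U, V). idx U V" and j = "\<lambda>T. (?U T, ?V T)"])
      fix T assume "T \<in> {T \<in> Pow ?I. ok T \<and> card ({0..<r} - T) = j}"
      then have T: "T \<subseteq> ?I" "ok T" "card ({0..<r} - T) = j" by auto
      show "(case (?U T, ?V T) of (U, V) \<Rightarrow> idx U V) = T"
        using idx[OF T(1)] by simp
      show "(case (?U T, ?V T) of (U, V) \<Rightarrow> D (idx U V)) = D T"
        using idx[OF T(1)] by simp
      show "(?U T, ?V T) \<in> {(U, V). X \<subseteq> U \<and> U \<subseteq> A - B \<and> Y \<subseteq> V \<and> V \<subseteq> B - A \<and> card U = j}"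
        using ok_iff[OF T(1)] T(2,3) card_U[of T] by simp
    next
      fix b assume "b \<in> {(U, V). X \<subseteq> U \<and> U \<subseteq> A - B \<and> Y \<subseteq> V \<and> V \<subseteq> B - A \<and> card U = j}"
      then obtain U V where b: "b = (U, V)" and bUV: "X \<subseteq> U" "U \<subseteq> A - B" "Y \<subseteq> V" "V \<subseteq> B - A" "card U = j"
        by blast
      have uv: "?U (idx U V) = U" "?V (idx U V) = V"
        using UV[of U V] bUV by blast+
      have I: "idx U V \<subseteq> ?I" by (auto simp: idx_def)
      show "(?U (case b of (U, V) \<Rightarrow> idx U V), ?V (case b of (U, V) \<Rightarrow> idx U V)) = b"
        using uv b by simp
      show "(case b of (U, V) \<Rightarrow> idx U V) \<in> {T \<in> Pow ?I. ok T \<and> card ({0..<r} - T) = j}"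
        using I ok_iff[OF I] card_U[of "idx U V"] bUV unfolding uv b by simp
    qed
    finally show ?thesis .
  qed
  with dvd D_nz show thesis by (rule that[of p "\<lambda>U V. D (idx U V)"])
qed

section \<open>Rank deficiency against the number of terms\<close>

theorem theorem1p11:
  fixes E :: "'a set" and Bs :: "'a set set" and A B X Y :: "'a set"
  assumes "matroid E Bs"
    and "representable_over TYPE('f::field_char_0) E Bs"
    and "A \<subseteq> E" and "B \<subseteq> E"
    and "card A = matroid_rank Bs E" and "card B = matroid_rank Bs E"
    and "X \<subseteq> A - B" and "Y \<subseteq> B - A"
    and "matroid_rank Bs (X \<union> Y) < card (A - B)"
    and "\<exists>!(U, V). U \<subseteq> A - B \<and> V \<subseteq> B - A \<and> X \<subseteq> U \<and> Y \<subseteq> V \<and>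
           card U = card V \<and> card V \<le> matroid_rank Bs (X \<union> Y) \<and>
           (A - U) \<union> V \<in> Bs \<and> (B - V) \<union> U \<in> Bs"
  shows "A \<in> Bs \<and> B \<in> Bs"
proof (rule ccontr)
  assume not_bases: "\<not> (A \<in> Bs \<and> B \<in> Bs)"
  interpret matroid E Bs by fact
  have fin: "finite A" "finite B"
    using assms(3,4) finite_ground by (auto intro: finite_subset)
  have Bs_Pow: "Bs \<subseteq> Pow E" using bases_subset by blast
  then have finBs: "finite Bs" using finite_ground by (simp add: finite_subset)
  obtain r and g :: "'a \<Rightarrow> nat \<Rightarrow> 'f"
    where g: "\<And>S. S \<subseteq> E \<Longrightarrow> S \<in> Bs \<longleftrightarrow> card S = r \<and> lin_indep r g S"
    using representable_lin_indep[OF assms(2)] by blast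
  define \<rho> where "\<rho> = matroid_rank Bs (X \<union> Y)"
  define d where "d = card (A - B)"
  \<comment> \<open>On these elements the lower weight \<open>c i - a i\<close> is -1, 1 or the
    variable, not a multiple of \<open>[:-1, 1:]\<close>, so divisibility comes from vanishing
    coordinates instead.\<close>
  let ?W = "X \<union> Y \<union> A \<inter> B"
  have W: "?W \<subseteq> E" using assms(3,4,7,8) by blast
  obtain B0 K and h :: "'a \<Rightarrow> nat \<Rightarrow> 'f" where B0: "B0 \<in> Bs"
    and h: "\<And>S. S \<subseteq> E \<Longrightarrow> S \<in> Bs \<longleftrightarrow> card S = r \<and> lin_indep r h S"
    and K: "K \<subseteq> {0..<r}" "card K = r - card (B0 \<inter> ?W)"
    and zero: "\<And>k x. k \<in> K \<Longrightarrow> x \<in> ?W \<Longrightarrow> h x k = 0"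
    by (rule adapted_representation[OF finite_ground Bs_Pow bases_nonempty g W]) blast+
  have "card (E \<inter> S) = r" if "S \<in> Bs" for S
    using g[of S] bases_subset[OF that] that by (simp add: Int_absorb1)
  then have "{card (E \<inter> S) | S. S \<in> Bs} = {r}"
    using B0 by blast
  then have "matroid_rank Bs E = r" by (simp add: matroid_rank_def)
  then have cards: "card A = r" "card B = r" using assms(5,6) by auto
  have dA: "r = d + card (A \<inter> B)"
    using card_Int_Diff[OF fin(1), of B] cards(1) by (simp add: d_def)
  have dB: "card (B - A) = d"
    using card_Int_Diff[OF fin(2), of A] cards(2) dA by (simp add: Int_commute)
  have \<rho>d: "\<rho> < d" using assms(9) by (simp add: \<rho>_def d_def)
  have "card ((X \<union> Y) \<inter> B0) \<le> \<rho>"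
    unfolding \<rho>_def matroid_rank_def using B0 finBs by (intro Max_ge) auto
  moreover have "card (B0 \<inter> ?W) \<le> card ((X \<union> Y) \<inter> B0) + card (A \<inter> B)"
    using fin assms(7,8) by (intro order_trans[OF card_mono card_Un_le]) (auto intro: finite_subset)
  ultimately have cardK: "d - \<rho> \<le> card K"
    using K(2) dA by linarith
  obtain p and \<delta> :: "'a set \<Rightarrow> 'a set \<Rightarrow> 'f"
    where dvd: "[:-1, 1:] ^ card K dvd p"
      and \<delta>: "\<And>U V. U \<subseteq> A - B \<Longrightarrow> V \<subseteq> B - A \<Longrightarrow>
        \<delta> U V \<noteq> 0 \<longleftrightarrow> lin_indep r h ((A - U) \<union> V) \<and> lin_indep r h ((B - V) \<union> U)"
      and coeff: "\<And>j. coeff p j =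
        (\<Sum>(U, V) | X \<subseteq> U \<and> U \<subseteq> A - B \<and> Y \<subseteq> V \<and> V \<subseteq> B - A \<and> card U = j. \<delta> U V)"
    by (rule exchange_polynomial[OF fin cards assms(7,8) K(1) zero]) blast+
  define good where "good U V \<longleftrightarrow> U \<subseteq> A - B \<and> V \<subseteq> B - A \<and> X \<subseteq> U \<and> Y \<subseteq> V \<and>
    card U = card V \<and> card V \<le> \<rho> \<and> (A - U) \<union> V \<in> Bs \<and> (B - V) \<union> U \<in> Bs" for U V
  have "\<exists>!(U, V). good U V" using assms(10) by (simp add: good_def \<rho>_def)
  then obtain U0 V0 where good0: "good U0 V0"
    and unique: "\<And>U V. good U V \<Longrightarrow> U = U0 \<and> V = V0"
    by (auto simp: Ex1_def)
  \<comment> \<open>\<open>\<delta>\<close> records independence only. The exchanged sets have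
    \<open>r - card U + card V\<close> and \<open>r - card V + card U\<close> elements, neither more
    than \<open>r\<close>, so \<open>U\<close> and \<open>V\<close> have equal size and both sets
    are bases.\<close>
  have bases: "card U = card V \<and> (A - U) \<union> V \<in> Bs \<and> (B - V) \<union> U \<in> Bs"
    if UV: "U \<subseteq> A - B" "V \<subseteq> B - A" and nz: "\<delta> U V \<noteq> 0" for U V
  proof -
    have L: "lin_indep r h ((A - U) \<union> V)" "lin_indep r h ((B - V) \<union> U)"
      using \<delta>[OF UV] nz by auto
    have finUV: "finite U" "finite V" using UV fin by (auto intro: finite_subset)
    have "U \<subseteq> A" "V \<subseteq> B" using UV by auto
    then have le: "card U \<le> r" "card V \<le> r" using fin cards by (metis card_mono)+
    have "card ((A - U) \<union> V) = card (A - U) + card V" "card ((B - V) \<union> U) = card (B - V) + card U"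
      using UV fin finUV by (auto intro!: card_Un_disjoint)
    then have c: "card ((A - U) \<union> V) = r - card U + card V" "card ((B - V) \<union> U) = r - card V + card U"
      using cards finUV \<open>U \<subseteq> A\<close> \<open>V \<subseteq> B\<close> by (simp_all add: card_Diff_subset)
    moreover have "card ((A - U) \<union> V) \<le> r" "card ((B - V) \<union> U) \<le> r"
      using L fin finUV by (auto intro: lin_indep_card_le)
    ultimately have "card U = card V" using le by linarith
    moreover have "(A - U) \<union> V \<subseteq> E" "(B - V) \<union> U \<subseteq> E" using UV assms(3,4) by auto
    ultimately show ?thesis using h L c le by simp
  qed
  \<comment> \<open>Degree \<open>d\<close> would need \<open>U = A - B\<close> and
    \<open>V = B - A\<close>, an exchange that swaps \<open>A\<close> and \<open>B\<close> and so
    makes both bases. Degrees up to \<open>\<rho>\<close> come from good pairs, hence from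
    \<open>U0\<close> alone; \<open>d - \<rho> - 1\<close> degrees remain in between.\<close>
  have "{j. coeff p j \<noteq> 0} \<subseteq> insert (card U0) {\<rho><..<d}"
  proof
    fix j assume "j \<in> {j. coeff p j \<noteq> 0}"
    then obtain U V where UV: "X \<subseteq> U" "U \<subseteq> A - B" "Y \<subseteq> V" "V \<subseteq> B - A" "card U = j" and nz: "\<delta> U V \<noteq> 0"
      unfolding coeff by (auto elim!: sum.not_neutral_contains_not_neutral)
    note bases = bases[OF UV(2,4) nz]
    have "j \<le> d" unfolding d_def UV(5)[symmetric] using UV(2) fin by (intro card_mono) auto
    moreover have "j \<noteq> d"
    proof
      assume j: "j = d"
      have "U = A - B" using UV(2,5) j fin by (intro card_subset_eq) (auto simp: d_def)
      moreover have "V = B - A"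
        using UV(4,5) j fin bases dB by (intro card_subset_eq) auto
      moreover have "(A - (A - B)) \<union> (B - A) = B" "(B - (B - A)) \<union> (A - B) = A" by auto
      ultimately show False using bases not_bases by simp
    qed
    moreover have "j = card U0" if "j \<le> \<rho>"
      using unique[of U V] UV bases that by (auto simp: good_def)
    ultimately show "j \<in> insert (card U0) {\<rho><..<d}" by force
  qed
  then have "card {j. coeff p j \<noteq> 0} \<le> card (insert (card U0) {\<rho><..<d})"
    by (rule card_mono[rotated]) simp
  also have "\<dots> \<le> Suc (card {\<rho><..<d})" by (rule card_insert_le_m1) auto
  also have "\<dots> \<le> card K" using cardK \<rho>d by simp
  finally have "p = 0" by (rule sparse_poly_eq_0[OF dvd])
  have gU0: "U0 \<subseteq> A - B" "V0 \<subseteq> B - A" "X \<subseteq> U0" "Y \<subseteq> V0" "card U0 = card V0" "card V0 \<le> \<rho>"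
    "(A - U0) \<union> V0 \<in> Bs" "(B - V0) \<union> U0 \<in> Bs"
    using good0 by (auto simp: good_def)
  let ?P = "{(U, V). X \<subseteq> U \<and> U \<subseteq> A - B \<and> Y \<subseteq> V \<and> V \<subseteq> B - A \<and> card U = card U0}"
  \<comment> \<open>Since \<open>card U0\<close> is at most \<open>\<rho>\<close>, any nonzero
    summand comes from a good pair, so only that of \<open>(U0, V0)\<close> survives.\<close>
  have "coeff p (card U0) = (\<Sum>(U, V)\<in>{(U0, V0)}. \<delta> U V)"
    unfolding coeff
  proof (rule sum.mono_neutral_right)
    have "?P \<subseteq> Pow A \<times> Pow B" by auto
    then show "finite ?P" using fin by (auto intro: finite_subset)
    show "{(U0, V0)} \<subseteq> ?P" using gU0 by auto
    show "\<forall>b\<in>?P - {(U0, V0)}. (case b of (U, V) \<Rightarrow> \<delta> U V) = 0"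
    proof
      fix b assume "b \<in> ?P - {(U0, V0)}"
      then obtain U V where b: "b = (U, V)" and ne: "\<not> (U = U0 \<and> V = V0)"
        and UV: "X \<subseteq> U" "U \<subseteq> A - B" "Y \<subseteq> V" "V \<subseteq> B - A" "card U = card U0"
        by auto
      have "\<delta> U V = 0"
      proof (rule ccontr)
        assume "\<delta> U V \<noteq> 0"
        then have "good U V" using bases[of U V] UV gU0 by (simp add: good_def)
        then show False using unique ne by blast
      qed
      then show "(case b of (U, V) \<Rightarrow> \<delta> U V) = 0" by (simp add: b)
    qed
  qed
  moreover have "\<delta> U0 V0 \<noteq> 0"
    using \<delta>[OF gU0(1,2)] gU0 h bases_subset by metis
  ultimately show False using \<open>p = 0\<close> by simp
qed

end
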